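(* Assume the following. (1) The operator $L^*-\partial_u f(x,v)$ possesses a negative eigenvalue $\lambda_1=-\sigma^2$ with corresponding nonnegative eigenfunction $\phi_1\in L^2(\Omega)$. (2) $b\in L^1_{loc}(0,\infty)$. (3) $a\in C^1(0,T)$ and there exists $a_0>0$ such that $a(t)\ge a_0$ for all $t\in[0,\infty)$. (4) $f(x,u)$ is $C^1$ and convex in $u$. (5) The functions $x\mapsto f(x,v(x))$ and $x\mapsto\partial_uf(x,v(x))$ are bounded. (6) There are $C>0$ and $p>1$ such that $f(x,u)\ge C|u|^p$ for every $(x,u)\in\Omega\times\mathbb{R}$. (7) $\phi_1\in L^1(\Omega)$ and $v\phi_1\in L^1(\Omega)$. Here $T\in(0,\infty]$ is given. Assume in addition that the coefficients satisfy $0<a_0\le a(t)\le a_1(t+1)^r$ for some constant $a_1$ and some $r\in[0,1)$, and $b\in L^\infty(0,T)$. Assume the initial data $(u_0,u_1)\in H^1(\Omega)\times L^2(\Omega)$ satisfy $\int_\Omega \phi_1(x)u_1(x)\,dx>0$ and $\int_\Omega\phi_1(x)u_0(x)\,dx>0$. If $u$ is a solution of $$a(t)\partial_{tt}u+b(t)\partial_t u+Lu=f(x,u),\qquad u(0,x)=v(x)+u_0(x),\qquad \partial_t u(0,x)=u_1(x),$$ with $x\in\Omega$, $t>0$, such that $u-v\in C^1([0,T);L^2(\Omega))$, then there exists $T^*<\infty$ such that $$\lim_{t\uparrow T^*}\|u(t)-v\|_2=+\infty .$$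
   Context: $\Omega$ is either $\mathbb{R}^n$ or a bounded domain in $\mathbb{R}^n$ with smooth boundary; in the bounded case Dirichlet boundary conditions are imposed on functions in the domain of $L$ and their derivatives up to a suitable order. $L$ is a linear differential operator in $x$ with smooth, bounded coefficients and $L^*$ is its adjoint. $f=f(x,u)$ is a real nonlinearity, and $a(t)$, $b(t)$ are real time-dependent coefficients ($b$ may change sign). $v\in C^2(\Omega)$ is a steady state: $Lv=f(x,v)$ in $\Omega$; $\partial_u f(x,v)$ in (1) denotes multiplication by $\partial_uf(x,v(x))$. $\|\cdot\|_2$ is the norm of $L^2(\Omega)$.
   Formalization: For finite T the statement fails (restrict a solution to a short time interval), so T is taken as the lifespan: if T is finite, it is assumed that the norm of u(t)-v tends to infinity as t tends to T. What is proved is that T = infinity is impossible. *)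

theory Defs
  imports "HOL-Analysis.Analysis"
begin

section \<open>Smooth functions and differential operators\<close>

definition partial :: "'n::finite \<Rightarrow> (real^'n \<Rightarrow> real) \<Rightarrow> real^'n \<Rightarrow> real" where
  "partial i w x = frechet_derivative w (at x) (axis i 1)"

text \<open>A list of coordinates [i1, ..., ik] serves as a multi-index of order k; it stands for the
  iterated partial derivative with respect to i1, ..., ik.\<close>

primrec partials :: "'n::finite list \<Rightarrow> (real^'n \<Rightarrow> real) \<Rightarrow> real^'n \<Rightarrow> real" where
  "partials [] w = w"
| "partials (i # \<alpha>) w = partial i (partials \<alpha> w)"

text \<open>Only used for open sets S.\<close>

primrec C_k :: "nat \<Rightarrow> (real^'n::finite) set \<Rightarrow> (real^'n \<Rightarrow> real) \<Rightarrow> bool" where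
  "C_k 0 S w \<longleftrightarrow> continuous_on S w"
| "C_k (Suc k) S w \<longleftrightarrow> (\<forall>x\<in>S. w differentiable (at x)) \<and> (\<forall>i. C_k k S (partial i w))"

definition smooth :: "(real^'n::finite) set \<Rightarrow> (real^'n \<Rightarrow> real) \<Rightarrow> bool" where
  "smooth S w \<longleftrightarrow> (\<forall>k. C_k k S w)"

definition test_fun :: "(real^'n::finite) set \<Rightarrow> (real^'n \<Rightarrow> real) \<Rightarrow> bool" where
  "test_fun S w \<longleftrightarrow> smooth UNIV w \<and> compact (closure {x. w x \<noteq> 0}) \<and> closure {x. w x \<noteq> 0} \<subseteq> S"

text \<open>The operator of order at most m with coefficients c. A derivative occurs once for each
  ordering of its multi-index, so the coefficient family of a given operator is not unique; every
  linear differential operator of order at most m is of this form.\<close>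

definition diff_op ::
  "nat \<Rightarrow> ('n::finite list \<Rightarrow> real^'n \<Rightarrow> real) \<Rightarrow> (real^'n \<Rightarrow> real) \<Rightarrow> real^'n \<Rightarrow> real" where
  "diff_op m c w x = (\<Sum>\<alpha> | length \<alpha> \<le> m. c \<alpha> x * partials \<alpha> w x)"

definition smooth_bounded_coeffs ::
  "(real^'n::finite) set \<Rightarrow> nat \<Rightarrow> ('n list \<Rightarrow> real^'n \<Rightarrow> real) \<Rightarrow> bool" where
  "smooth_bounded_coeffs \<Omega> m c \<longleftrightarrow>
     (\<forall>\<alpha>. length \<alpha> \<le> m \<longrightarrow> smooth \<Omega> (c \<alpha>) \<and> bounded (c \<alpha> ` \<Omega>))"


section \<open>The spatial domain\<close>

text \<open>Locally, the set is a strict sublevel set of a smooth function without critical points.\<close>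

definition smooth_boundary :: "(real^'n::finite) set \<Rightarrow> bool" where
  "smooth_boundary \<Omega> \<longleftrightarrow>
     (\<forall>p\<in>frontier \<Omega>. \<exists>U \<rho>. open U \<and> p \<in> U \<and> smooth U \<rho> \<and>
        (\<forall>x\<in>U. \<exists>i. partial i \<rho> x \<noteq> 0) \<and> \<Omega> \<inter> U = {x\<in>U. \<rho> x < 0})"

definition admissible_domain :: "(real^'n::finite) set \<Rightarrow> bool" where
  "admissible_domain \<Omega> \<longleftrightarrow> \<Omega> = UNIV \<or>
     (open \<Omega> \<and> connected \<Omega> \<and> \<Omega> \<noteq> {} \<and> bounded \<Omega> \<and> smooth_boundary \<Omega>)"


section \<open>Function spaces\<close>

definition L2 :: "(real^'n::finite) set \<Rightarrow> (real^'n \<Rightarrow> real) set" where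
  "L2 \<Omega> = {w. w \<in> borel_measurable (lebesgue_on \<Omega>) \<and> integrable (lebesgue_on \<Omega>) (\<lambda>x. (w x)\<^sup>2)}"

definition L2_inner :: "(real^'n::finite) set \<Rightarrow> (real^'n \<Rightarrow> real) \<Rightarrow> (real^'n \<Rightarrow> real) \<Rightarrow> real" where
  "L2_inner \<Omega> w z = (LINT x|lebesgue_on \<Omega>. w x * z x)"

definition L2_norm :: "(real^'n::finite) set \<Rightarrow> (real^'n \<Rightarrow> real) \<Rightarrow> real" where
  "L2_norm \<Omega> w = sqrt (LINT x|lebesgue_on \<Omega>. (w x)\<^sup>2)"

definition H1 :: "(real^'n::finite) set \<Rightarrow> (real^'n \<Rightarrow> real) set" where
  "H1 \<Omega> = {w \<in> L2 \<Omega>. \<forall>i. \<exists>g \<in> L2 \<Omega>. \<forall>\<psi>. test_fun \<Omega> \<psi> \<longrightarrow>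
     L2_inner \<Omega> w (partial i \<psi>) = - L2_inner \<Omega> g \<psi>}"

definition L1_loc_pos :: "(real \<Rightarrow> real) \<Rightarrow> bool" where
  "L1_loc_pos b \<longleftrightarrow> (\<forall>K. compact K \<and> K \<subseteq> {0<..} \<longrightarrow> set_integrable lebesgue K b)"

definition L_infinity :: "real set \<Rightarrow> (real \<Rightarrow> real) \<Rightarrow> bool" where
  "L_infinity I b \<longleftrightarrow> b \<in> borel_measurable (lebesgue_on I) \<and>
     (\<exists>B. AE t in lebesgue_on I. \<bar>b t\<bar> \<le> B)"

text \<open>The map w is in C1([0,T); L2) and w' is its derivative in the L2 norm, one-sided at 0.\<close>

definition C1_L2 :: "(real^'n::finite) set \<Rightarrow> ereal \<Rightarrow>
    (real \<Rightarrow> real^'n \<Rightarrow> real) \<Rightarrow> (real \<Rightarrow> real^'n \<Rightarrow> real) \<Rightarrow> bool" where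
  "C1_L2 \<Omega> T w w' \<longleftrightarrow>
     (\<forall>t. 0 \<le> t \<and> ereal t < T \<longrightarrow>
        w t \<in> L2 \<Omega> \<and> w' t \<in> L2 \<Omega> \<and>
        ((\<lambda>s. L2_norm \<Omega> (\<lambda>x. (w s x - w t x) / (s - t) - w' t x)) \<longlongrightarrow> 0)
          (at t within {s. 0 \<le> s \<and> ereal s < T}) \<and>
        ((\<lambda>s. L2_norm \<Omega> (\<lambda>x. w' s x - w' t x)) \<longlongrightarrow> 0)
          (at t within {s. 0 \<le> s \<and> ereal s < T}))"


section \<open>The realization of the operator in L2 and its adjoint\<close>

text \<open>Functions in the domain, together with their derivatives up to order k, vanish on the
  boundary; k is the suitable order of the Dirichlet conditions. On the whole space the boundary is
  empty and the domain consists of all test functions. Compact support is no restriction up to the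
  boundary when \<^term>\<open>\<Omega>\<close> is bounded, because only values on its closure matter. These smooth
  functions form a core of the usual Sobolev domains, so they determine the same adjoint.\<close>

definition op_domain :: "(real^'n::finite) set \<Rightarrow> nat \<Rightarrow> (real^'n \<Rightarrow> real) set" where
  "op_domain \<Omega> k = {w. test_fun UNIV w \<and>
     (\<forall>\<alpha>. length \<alpha> \<le> k \<longrightarrow> (\<forall>x\<in>frontier \<Omega>. partials \<alpha> w x = 0))}"

text \<open>The graph of the Hilbert space adjoint: z is in the domain of the adjoint, which maps it
  to y.\<close>

definition adjoint_graph :: "(real^'n::finite) set \<Rightarrow> nat \<Rightarrow> ('n list \<Rightarrow> real^'n \<Rightarrow> real) \<Rightarrow> nat \<Rightarrow>
    (real^'n \<Rightarrow> real) \<Rightarrow> (real^'n \<Rightarrow> real) \<Rightarrow> bool" where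
  "adjoint_graph \<Omega> m c k z y \<longleftrightarrow> z \<in> L2 \<Omega> \<and> y \<in> L2 \<Omega> \<and>
     (\<forall>w \<in> op_domain \<Omega> k. L2_inner \<Omega> (diff_op m c w) z = L2_inner \<Omega> w y)"

text \<open>The function z is an eigenfunction, for the eigenvalue lam, of the adjoint minus
  multiplication by q.\<close>

definition adjoint_minus_eigenfunction ::
  "(real^'n::finite) set \<Rightarrow> nat \<Rightarrow> ('n list \<Rightarrow> real^'n \<Rightarrow> real) \<Rightarrow> nat \<Rightarrow>
    (real^'n \<Rightarrow> real) \<Rightarrow> real \<Rightarrow> (real^'n \<Rightarrow> real) \<Rightarrow> bool" where
  "adjoint_minus_eigenfunction \<Omega> m c k q lam z \<longleftrightarrow>
     \<not> (AE x in lebesgue_on \<Omega>. z x = 0) \<and>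
     (\<exists>y. adjoint_graph \<Omega> m c k z y \<and> (AE x in lebesgue_on \<Omega>. y x - q x * z x = lam * z x))"


section \<open>Steady states and solutions\<close>

text \<open>For m at most 2 the second condition is implied by the first; for larger m it is what
  gives the classical equation a meaning.\<close>

definition steady_state :: "(real^'n::finite) set \<Rightarrow> nat \<Rightarrow> ('n list \<Rightarrow> real^'n \<Rightarrow> real) \<Rightarrow>
    (real^'n \<Rightarrow> real \<Rightarrow> real) \<Rightarrow> (real^'n \<Rightarrow> real) \<Rightarrow> bool" where
  "steady_state \<Omega> m c f v \<longleftrightarrow>
     C_k 2 \<Omega> v \<and> C_k m \<Omega> v \<and> (\<forall>x\<in>\<Omega>. diff_op m c v x = f x (v x))"

text \<open>Weak solutions of a(t) u_tt + b(t) u_t + L u = f(x,u) on (0,T), where ut is the time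
  derivative of u. Since only u - v lies in L2, the term L u is read as L v + L (u - v), with L v
  classical and L (u - v) tested against the domain of the adjoint (which also encodes the boundary
  conditions on u - v). Tested against such a function z, the velocity is locally absolutely
  continuous in time, with density h, and the equation holds for almost every time. The pairing of
  f(x,u) with z is only required to make sense.\<close>

definition weak_solution :: "(real^'n::finite) set \<Rightarrow> nat \<Rightarrow> ('n list \<Rightarrow> real^'n \<Rightarrow> real) \<Rightarrow> nat \<Rightarrow>
    (real \<Rightarrow> real) \<Rightarrow> (real \<Rightarrow> real) \<Rightarrow> (real^'n \<Rightarrow> real \<Rightarrow> real) \<Rightarrow> (real^'n \<Rightarrow> real) \<Rightarrow> ereal \<Rightarrow>
    (real \<Rightarrow> real^'n \<Rightarrow> real) \<Rightarrow> (real \<Rightarrow> real^'n \<Rightarrow> real) \<Rightarrow> bool" where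
  "weak_solution \<Omega> m c k a b f v T u ut \<longleftrightarrow>
     (\<forall>z y. adjoint_graph \<Omega> m c k z y \<longrightarrow>
       (\<exists>h.
         (\<forall>t. 0 \<le> t \<and> ereal t < T \<longrightarrow>
            set_integrable lebesgue {0..t} h \<and>
            L2_inner \<Omega> (ut t) z = L2_inner \<Omega> (ut 0) z + (LINT s:{0..t}|lebesgue. h s)) \<and>
         (AE t in lebesgue. 0 < t \<and> ereal t < T \<longrightarrow>
            integrable (lebesgue_on \<Omega>) (\<lambda>x. (f x (u t x) - diff_op m c v x) * z x) \<and>
            a t * h t + b t * L2_inner \<Omega> (ut t) z + L2_inner \<Omega> (\<lambda>x. u t x - v x) y
              = L2_inner \<Omega> (\<lambda>x. f x (u t x) - diff_op m c v x) z)))"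

end

theory Submission
  imports Defs "HOL-Real_Asymp.Real_Asymp"
begin

text \<open>If \<open>T\<close> is finite, the norm blows up at \<open>T\<close> because \<open>T\<close> is the lifespan. The content of the
  theorem is that \<open>T = \<infinity>\<close> is impossible, and this is seen on the single scalar function
  \<open>F t = \<langle>u t - v, \<phi>1\<rangle>\<close>.

  Testing the equation with the eigenfunction moves the linear part onto \<open>\<phi>1\<close> and gives
  \<open>a F'' + b F' = \<integral> (f(x,u) - f(x,v) - \<partial>\<^sub>u f(x,v) (u - v)) \<phi>1 + \<sigma>\<^sup>2 F\<close>.
  By convexity the integral is nonnegative, so the right-hand side is at least \<open>\<sigma>\<^sup>2 F\<close>; by
  \<open>f(x,u) \<ge> C |u|^p\<close> and Jensen's inequality it grows at least like \<open>F^p\<close> when \<open>F\<close> is large. As long as \<open>F\<close>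
  stays above its positive initial value, both bounds combine to \<open>a F'' + b F' \<ge> c F^p\<close> with some
  \<open>c > 0\<close>; this is \<open>superlinear_forcing\<close>.

  For this differential inequality (\<open>no_global_solution\<close>), \<open>F'\<close> can never reach zero, since at a
  first zero the damping term vanishes and \<open>F'\<close> would be increasing there. Hence \<open>F\<close> increases, and
  the sign of \<open>b\<close> is harmless: the damping costs at most \<open>B F'\<close>. Then
  \<open>F' > \<epsilon> F^q / (1 + t)\<close> with \<open>q = (p + 1) / 2 > 1\<close> is preserved in time if \<open>\<epsilon>\<close> is small: at a first
  time of equality the damping is dominated by \<open>c F^p\<close>, so \<open>F''\<close> is at least a multiple of
  \<open>F^p / (1 + t)\<^sup>2\<close>, while the right-hand side grows at most at rate \<open>\<epsilon>\<^sup>2 q F^p / (1 + t)\<^sup>2\<close>.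
  Integrating \<open>F' / F^q > \<epsilon> / (1 + t)\<close>, the bounded quantity \<open>F^(1 - q)\<close> has to absorb a logarithm
  that tends to infinity, which is the contradiction.

  The velocity \<open>F'\<close> is only absolutely continuous, with \<open>F''\<close> an integrable density. Therefore the
  comparison arguments use increments of \<open>F'\<close> near a first crossing time (\<open>stays_above\<close>) in place
  of a pointwise second derivative.\<close>

section \<open>Power inequalities\<close>

text \<open>This tangent inequality, integrated against a weight, replaces Jensen's inequality for
  \<open>\<bar>y\<bar>\<^sup>p\<close>: the point of tangency \<open>s\<close> need not be the mean, which gives room to choose it
  conveniently.\<close>

lemma abs_powr_above_tangent:
  fixes s y p :: real
  assumes "1 < p" "0 < s"
  shows "s powr p + p * s powr (p - 1) * (y - s) \<le> \<bar>y\<bar> powr p"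
proof (cases "0 < y")
  case True
  have "p * s powr (p - 1) * (y - s) \<le> y powr p - s powr p"
  proof (rule convex_on_imp_above_tangent[where A = "{0<..}"])
    show "convex_on {0<..} (\<lambda>x::real. x powr p)"
      by (rule f''_ge0_imp_convex[where f' = "\<lambda>x. p * x powr (p - 1)"
            and f'' = "\<lambda>x. p * ((p - 1) * x powr (p - 2))"])
         (use assms in \<open>auto intro!: derivative_eq_intros\<close>)
    show "((\<lambda>x. x powr p) has_real_derivative p * s powr (p - 1)) (at s within {0<..})"
      using assms by (auto intro!: derivative_eq_intros)
  qed (use assms True in \<open>auto simp: interior_open\<close>)
  then show ?thesis using True by simp
next
  case False
  (* Here the tangent line is already nonpositive. *)
  have "s powr p = s * s powr (p - 1)"
    using assms by (simp add: powr_mult_base)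
  then have "s powr p + p * s powr (p - 1) * (y - s) = s powr (p - 1) * ((1 - p) * s + p * y)"
    by (simp add: algebra_simps)
  also have "\<dots> \<le> 0"
    using assms False
    by (intro mult_nonneg_nonpos add_nonpos_nonpos mult_nonpos_nonneg) auto
  finally show ?thesis by (meson order_trans powr_ge_zero)
qed

text \<open>Superlinear growth absorbs a linear term, up to a constant.\<close>

lemma linear_le_powr:
  fixes C p M :: real
  assumes "0 < C" "1 < p" "0 \<le> M"
  obtains D where "0 \<le> D" "\<And>z. 0 \<le> z \<Longrightarrow> M * z \<le> C * z powr p + D"
proof -
  have "eventually (\<lambda>z. M * z \<le> C * z powr p) at_top"
    using assms by real_asymp
  then obtain Z where Z: "\<And>z. Z \<le> z \<Longrightarrow> M * z \<le> C * z powr p"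
    by (auto simp: eventually_at_top_linorder)
  have "M * z \<le> C * z powr p + M * max Z 0" if "0 \<le> z" for z
    using Z[of z] assms that mult_left_mono[of z "max Z 0" M]
    by (cases "Z \<le> z") (auto intro: add_increasing add_increasing2)
  then show thesis using that[of "M * max Z 0"] assms by auto
qed

section \<open>The pairing of square-integrable functions\<close>

text \<open>The discriminant argument: the integral of \<open>(w - l z)\<^sup>2\<close> is a nonnegative quadratic polynomial
  in \<open>l\<close>.\<close>

lemma Cauchy_Schwarz_integral:
  fixes w z :: "'a \<Rightarrow> real"
  assumes [measurable]: "w \<in> borel_measurable N" "z \<in> borel_measurable N"
    and w2: "integrable N (\<lambda>x. (w x)\<^sup>2)" and z2: "integrable N (\<lambda>x. (z x)\<^sup>2)"
  shows "integrable N (\<lambda>x. w x * z x)"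
    and "\<bar>LINT x|N. w x * z x\<bar> \<le> sqrt (LINT x|N. (w x)\<^sup>2) * sqrt (LINT x|N. (z x)\<^sup>2)"
proof -
  show wz: "integrable N (\<lambda>x. w x * z x)"
  proof (rule Bochner_Integration.integrable_bound[OF Bochner_Integration.integrable_add[OF w2 z2]])
    have "\<bar>w x * z x\<bar> \<le> (w x)\<^sup>2 + (z x)\<^sup>2" for x
    proof -
      have "0 \<le> \<bar>w x\<bar> * \<bar>z x\<bar>" by simp
      then show ?thesis
        using sum_squares_bound[of "\<bar>w x\<bar>" "\<bar>z x\<bar>"]
        unfolding abs_mult power2_abs by linarith
    qed
    then show "AE x in N. norm (w x * z x) \<le> norm ((w x)\<^sup>2 + (z x)\<^sup>2)" by simp
  qed simp
  define A B C where "A = (LINT x|N. (w x)\<^sup>2)" and "B = (LINT x|N. w x * z x)"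
    and "C = (LINT x|N. (z x)\<^sup>2)"
  have quad: "0 \<le> A - 2 * l * B + l\<^sup>2 * C" for l
  proof -
    have "0 \<le> (LINT x|N. (w x - l * z x)\<^sup>2)" by simp
    also have "(\<lambda>x. (w x - l * z x)\<^sup>2) = (\<lambda>x. (w x)\<^sup>2 - 2 * l * (w x * z x) + l\<^sup>2 * (z x)\<^sup>2)"
      by (auto simp: power2_eq_square algebra_simps)
    also have "(LINT x|N. (w x)\<^sup>2 - 2 * l * (w x * z x) + l\<^sup>2 * (z x)\<^sup>2) = A - 2 * l * B + l\<^sup>2 * C"
      using w2 z2 wz by (simp add: A_def B_def C_def)
    finally show ?thesis .
  qed
  have nonneg: "0 \<le> A" "0 \<le> C" by (simp_all add: A_def C_def)
  have "B\<^sup>2 \<le> A * C"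
  proof (cases "C = 0")
    case True
    (* A nonnegative affine function of l has slope zero. *)
    have "B = 0"
      using quad[of "(A + 1) / (2 * B)"] True by (cases "B = 0") auto
    then show ?thesis using True by simp
  next
    case False
    then show ?thesis
      using quad[of "B / C"] nonneg by (auto simp: field_simps power2_eq_square)
  qed
  then have "\<bar>B\<bar> \<le> sqrt (A * C)" by (metis real_sqrt_abs real_sqrt_le_iff)
  then show "\<bar>LINT x|N. w x * z x\<bar> \<le> sqrt (LINT x|N. (w x)\<^sup>2) * sqrt (LINT x|N. (z x)\<^sup>2)"
    by (simp add: A_def B_def C_def real_sqrt_mult)
qed

lemma L2_diff: "w \<in> L2 \<Omega> \<Longrightarrow> z \<in> L2 \<Omega> \<Longrightarrow> (\<lambda>x. w x - z x) \<in> L2 \<Omega>"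
proof -
  assume *: "w \<in> L2 \<Omega>" "z \<in> L2 \<Omega>"
  then have "integrable (lebesgue_on \<Omega>) (\<lambda>x. w x * z x)"
    by (intro Cauchy_Schwarz_integral) (auto simp: L2_def)
  then have "integrable (lebesgue_on \<Omega>) (\<lambda>x. (w x)\<^sup>2 + (z x)\<^sup>2 - 2 * (w x * z x))"
    using * by (intro Bochner_Integration.integrable_diff Bochner_Integration.integrable_add
        integrable_mult_right) (auto simp: L2_def)
  then show ?thesis using * by (auto simp: L2_def power2_diff mult.assoc)
qed

lemma L2_divide: "w \<in> L2 \<Omega> \<Longrightarrow> (\<lambda>x. w x / c) \<in> L2 \<Omega>"
  by (auto simp: L2_def power_divide)

lemma L2_inner_integrable:
  "w \<in> L2 \<Omega> \<Longrightarrow> z \<in> L2 \<Omega> \<Longrightarrow> integrable (lebesgue_on \<Omega>) (\<lambda>x. w x * z x)"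
  by (intro Cauchy_Schwarz_integral) (auto simp: L2_def)

lemma abs_L2_inner_le: "w \<in> L2 \<Omega> \<Longrightarrow> z \<in> L2 \<Omega> \<Longrightarrow> \<bar>L2_inner \<Omega> w z\<bar> \<le> L2_norm \<Omega> w * L2_norm \<Omega> z"
  unfolding L2_inner_def L2_norm_def by (intro Cauchy_Schwarz_integral) (auto simp: L2_def)

lemma L2_inner_diff_left:
  "w \<in> L2 \<Omega> \<Longrightarrow> w' \<in> L2 \<Omega> \<Longrightarrow> z \<in> L2 \<Omega> \<Longrightarrow>
    L2_inner \<Omega> (\<lambda>x. w x - w' x) z = L2_inner \<Omega> w z - L2_inner \<Omega> w' z"
  by (simp add: L2_inner_def left_diff_distrib L2_inner_integrable)

lemma L2_inner_divide_left: "L2_inner \<Omega> (\<lambda>x. w x / c) z = L2_inner \<Omega> w z / c"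
  by (simp add: L2_inner_def)

lemma L2_inner_cong_AE:
  assumes "w \<in> L2 \<Omega>" "w' \<in> L2 \<Omega>" "z \<in> L2 \<Omega>" and ae: "AE x in lebesgue_on \<Omega>. w x = w' x"
  shows "L2_inner \<Omega> w z = L2_inner \<Omega> w' z"
proof -
  have [measurable]: "w \<in> borel_measurable (lebesgue_on \<Omega>)" "w' \<in> borel_measurable (lebesgue_on \<Omega>)"
    "z \<in> borel_measurable (lebesgue_on \<Omega>)"
    using assms by (simp_all add: L2_def)
  show ?thesis
    unfolding L2_inner_def
    by (rule integral_cong_AE) (use ae in \<open>auto elim: eventually_mono\<close>)
qed

text \<open>Pairing with a fixed function is a bounded functional by the Cauchy-Schwarz inequality, so it
  carries the difference quotients in norm to those of the scalar function.\<close>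

lemma C1_L2_pairing:
  assumes C1: "C1_L2 \<Omega> T w w'" and z: "z \<in> L2 \<Omega>"
  defines "I \<equiv> {t. 0 \<le> t \<and> ereal t < T}"
  shows "t \<in> I \<Longrightarrow>
      ((\<lambda>t. L2_inner \<Omega> (w t) z) has_real_derivative L2_inner \<Omega> (w' t) z) (at t within I)"
    and "continuous_on I (\<lambda>t. L2_inner \<Omega> (w' t) z)"
proof -
  have L2: "w t \<in> L2 \<Omega>" "w' t \<in> L2 \<Omega>" if "t \<in> I" for t
    using C1 that by (auto simp: C1_L2_def I_def)
  have inI: "eventually (\<lambda>s. s \<in> I) (at t within I)" for t
    by (simp add: eventually_at_filter)
  show "((\<lambda>t. L2_inner \<Omega> (w t) z) has_real_derivative L2_inner \<Omega> (w' t) z) (at t within I)"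
    if t: "t \<in> I" for t
  proof -
    let ?e = "\<lambda>s x. (w s x - w t x) / (s - t) - w' t x"
    let ?Q = "\<lambda>s. (L2_inner \<Omega> (w s) z - L2_inner \<Omega> (w t) z) / (s - t)"
    have "((\<lambda>s. L2_norm \<Omega> (?e s)) \<longlongrightarrow> 0) (at t within I)"
      using C1 t by (auto simp: C1_L2_def I_def)
    then have "((\<lambda>s. L2_norm \<Omega> (?e s) * L2_norm \<Omega> z) \<longlongrightarrow> 0) (at t within I)"
      by (rule tendsto_mult_left_zero)
    moreover have "eventually (\<lambda>s. \<bar>?Q s - L2_inner \<Omega> (w' t) z\<bar> \<le> L2_norm \<Omega> (?e s) * L2_norm \<Omega> z)
        (at t within I)"
      using inI[of t]
    proof eventually_elim
      case (elim s)
      have d: "(\<lambda>x. w s x - w t x) \<in> L2 \<Omega>" using L2 elim t by (intro L2_diff) auto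
      have "?Q s - L2_inner \<Omega> (w' t) z = L2_inner \<Omega> (?e s) z"
        using L2_inner_diff_left[OF L2_divide[OF d] L2(2)[OF t] z]
          L2_inner_diff_left[OF L2(1)[OF elim] L2(1)[OF t] z]
        by (simp add: L2_inner_divide_left)
      then show ?case
        using abs_L2_inner_le[OF L2_diff[OF L2_divide[OF d] L2(2)[OF t]] z] by simp
    qed
    ultimately have "((\<lambda>s. ?Q s - L2_inner \<Omega> (w' t) z) \<longlongrightarrow> 0) (at t within I)"
      by (rule_tac Lim_null_comparison) auto
    then show ?thesis by (simp add: has_field_derivative_iff LIM_zero_iff)
  qed
  show "continuous_on I (\<lambda>t. L2_inner \<Omega> (w' t) z)"
    unfolding continuous_on_def
  proof
    fix t assume t: "t \<in> I"
    let ?d = "\<lambda>s x. w' s x - w' t x"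
    have "((\<lambda>s. L2_norm \<Omega> (?d s)) \<longlongrightarrow> 0) (at t within I)"
      using C1 t by (auto simp: C1_L2_def I_def)
    then have "((\<lambda>s. L2_norm \<Omega> (?d s) * L2_norm \<Omega> z) \<longlongrightarrow> 0) (at t within I)"
      by (rule tendsto_mult_left_zero)
    moreover have "eventually (\<lambda>s. \<bar>L2_inner \<Omega> (w' s) z - L2_inner \<Omega> (w' t) z\<bar>
        \<le> L2_norm \<Omega> (?d s) * L2_norm \<Omega> z) (at t within I)"
      using inI[of t]
    proof eventually_elim
      case (elim s)
      then show ?case
        using abs_L2_inner_le[OF L2_diff[OF L2(2)[OF elim] L2(2)[OF t]] z]
          L2_inner_diff_left[OF L2(2)[OF elim] L2(2)[OF t] z] by simp
    qed
    ultimately have "((\<lambda>s. L2_inner \<Omega> (w' s) z - L2_inner \<Omega> (w' t) z) \<longlongrightarrow> 0) (at t within I)"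
      by (rule_tac Lim_null_comparison) auto
    then show "((\<lambda>s. L2_inner \<Omega> (w' s) z) \<longlongrightarrow> L2_inner \<Omega> (w' t) z) (at t within I)"
      by (simp add: LIM_zero_iff)
  qed
qed

section \<open>The forcing term tested against the eigenfunction\<close>

text \<open>Two bounds are combined. The tangent inequality for \<open>f\<close> gives \<open>- lam * F\<close>, with
  \<open>F = \<integral> (u - v) \<phi>\<close>; this is used on the bounded range where \<open>F\<close> is not large, and there it
  dominates a small multiple of \<open>F^p\<close> because \<open>F \<ge> m > 0\<close>. For large \<open>F\<close> the growth of \<open>f\<close> is used,
  half of \<open>C |u|^p\<close> being spent on the linear terms. The constant depends only on \<open>m\<close> and on the
  data, not on \<open>u\<close>, so that it serves for all times simultaneously.\<close>

lemma superlinear_forcing: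
  fixes N :: "'a measure" and \<phi> v q y :: "'a \<Rightarrow> real" and f :: "'a \<Rightarrow> real \<Rightarrow> real"
  assumes \<phi>: "integrable N \<phi>" "AE x in N. 0 \<le> \<phi> x" "0 < (LINT x|N. \<phi> x)"
    and v\<phi>: "integrable N (\<lambda>x. v x * \<phi> x)"
    and above_tangent: "\<And>x z. x \<in> space N \<Longrightarrow> q x * (z - v x) \<le> f x z - f x (v x)"
    and coercive: "\<And>x z. x \<in> space N \<Longrightarrow> C * \<bar>z\<bar> powr p \<le> f x z" "0 < C" "1 < p"
    and bounds: "\<And>x. x \<in> space N \<Longrightarrow> f x (v x) \<le> K" "\<And>x. x \<in> space N \<Longrightarrow> \<bar>q x\<bar> \<le> M" "0 \<le> M"
    and eigen: "AE x in N. y x - q x * \<phi> x = lam * \<phi> x" "lam < 0"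
    and m: "0 < m"
  obtains c where "0 < c"
    "\<And>u. \<lbrakk>integrable N (\<lambda>x. (u x - v x) * \<phi> x); integrable N (\<lambda>x. (u x - v x) * y x);
        integrable N (\<lambda>x. (f x (u x) - f x (v x)) * \<phi> x); m \<le> (LINT x|N. (u x - v x) * \<phi> x)\<rbrakk>
      \<Longrightarrow> c * (LINT x|N. (u x - v x) * \<phi> x) powr p
          \<le> (LINT x|N. (f x (u x) - f x (v x)) * \<phi> x) - (LINT x|N. (u x - v x) * y x)"
proof -
  define \<Phi> V V1 where "\<Phi> = (LINT x|N. \<phi> x)" and "V = (LINT x|N. v x * \<phi> x)"
    and "V1 = (LINT x|N. \<bar>v x * \<phi> x\<bar>)"
  have \<Phi>: "0 < \<Phi>" using \<phi> by (simp add: \<Phi>_def)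
  obtain D where D: "0 \<le> D" "\<And>z. 0 \<le> z \<Longrightarrow> M * z \<le> C / 2 * z powr p + D"
    using linear_le_powr[of "C / 2" p M] coercive bounds(3) by auto
  define E where "E = (D + K) * \<Phi> + M * V1"
  (* A quarter of C, not a half: the other quarter of C absorbs the constant E for large F. *)
  define c1 where "c1 = C / 4 * \<Phi> * (1 / (2 * \<Phi>)) powr p"
  have c1: "0 < c1" using \<Phi> coercive by (simp add: c1_def)
  have "filterlim (\<lambda>F. c1 * F powr p) at_top at_top"
    using c1 coercive by real_asymp
  then have "eventually (\<lambda>F. E \<le> c1 * F powr p) at_top"
    by (simp add: filterlim_at_top)
  then obtain F1 where F1: "\<And>F. F1 \<le> F \<Longrightarrow> E \<le> c1 * F powr p"
    by (auto simp: eventually_at_top_linorder)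
  define F0 where "F0 = max (max F1 (2 * \<bar>V\<bar>)) m"
  have F0: "F1 \<le> F0" "2 * \<bar>V\<bar> \<le> F0" "m \<le> F0" "0 < F0" using m by (auto simp: F0_def)
  define c where "c = min c1 (- lam * m / F0 powr p)"
  have "0 < - lam * m / F0 powr p" using eigen m F0 by (intro divide_pos_pos mult_pos_pos) auto
  then have c: "0 < c" using c1 by (simp add: c_def)
  show thesis
  proof (rule that[OF c])
    fix u
    assume w\<phi>: "integrable N (\<lambda>x. (u x - v x) * \<phi> x)" and wy: "integrable N (\<lambda>x. (u x - v x) * y x)"
      and f\<phi>: "integrable N (\<lambda>x. (f x (u x) - f x (v x)) * \<phi> x)"
      and mF: "m \<le> (LINT x|N. (u x - v x) * \<phi> x)"
    define F G where "F = (LINT x|N. (u x - v x) * \<phi> x)"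
      and "G = (LINT x|N. (f x (u x) - f x (v x)) * \<phi> x) - (LINT x|N. (u x - v x) * y x)"
    have G: "G = (LINT x|N. (f x (u x) - f x (v x)) * \<phi> x - (u x - v x) * y x)"
      using f\<phi> wy by (simp add: G_def)
    have F: "m \<le> F" "0 < F" using mF m by (auto simp: F_def)
    (* The eigenvalue equation isolates the convexity defect of f, which is nonnegative. *)
    have split: "AE x in N. (f x (u x) - f x (v x)) * \<phi> x - (u x - v x) * y x
        = (f x (u x) - f x (v x) - q x * (u x - v x)) * \<phi> x - lam * ((u x - v x) * \<phi> x)"
      using eigen(1)
    proof eventually_elim
      case (elim x)
      then have "y x = q x * \<phi> x + lam * \<phi> x" by simp
      then show ?case by (simp add: algebra_simps)
    qed
    have linear: "- lam * F \<le> G"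
    proof -
      have "AE x in N. - lam * ((u x - v x) * \<phi> x)
          \<le> (f x (u x) - f x (v x)) * \<phi> x - (u x - v x) * y x"
        using split \<phi>(2) AE_space
      proof eventually_elim
        case (elim x)
        have "0 \<le> (f x (u x) - f x (v x) - q x * (u x - v x)) * \<phi> x"
          using elim above_tangent[of x "u x"] by (intro mult_nonneg_nonneg) auto
        then show ?case using elim(1) by linarith
      qed
      then have "(LINT x|N. - lam * ((u x - v x) * \<phi> x)) \<le> G"
        unfolding G using w\<phi> wy f\<phi> by (intro integral_mono_AE) auto
      then show ?thesis by (simp add: F_def)
    qed
    show "c * (LINT x|N. (u x - v x) * \<phi> x) powr p
          \<le> (LINT x|N. (f x (u x) - f x (v x)) * \<phi> x) - (LINT x|N. (u x - v x) * y x)"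
      unfolding F_def[symmetric] G_def[symmetric]
    proof (cases "F0 \<le> F")
      case False
      have "F powr p \<le> F0 powr p" using False F coercive by (intro powr_mono2) auto
      then have "c * F powr p \<le> (- lam * m / F0 powr p) * F0 powr p"
        using c by (intro mult_mono) (auto simp: c_def)
      also have "\<dots> = - lam * m" using F0 by simp
      also have "\<dots> \<le> - lam * F" using F eigen by (intro mult_left_mono) auto
      finally show "c * F powr p \<le> G" using linear by linarith
    next
      case True
      (* Half of F / \<Phi>, so that the mean of u, which is (F + V) / \<Phi>, is still at least s. *)
      define s where "s = F / (2 * \<Phi>)"
      have s: "0 < s" using F \<Phi> by (simp add: s_def)
      define \<alpha> \<beta> where "\<alpha> = C / 2 * (s powr p - p * s powr p) - (D + K)"
        and "\<beta> = C / 2 * p * s powr (p - 1)"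
      have "s powr (p - 1) * s = s powr p"
        using s powr_mult_base[of s "p - 1"] by (simp add: mult.commute)
      then have \<beta>: "0 \<le> \<beta>" "\<beta> * s = C / 2 * p * s powr p"
        using coercive by (simp_all add: \<beta>_def mult.assoc)
      have "AE x in N. \<alpha> * \<phi> x + \<beta> * ((u x - v x) * \<phi> x + v x * \<phi> x) - M * \<bar>v x * \<phi> x\<bar>
            - lam * ((u x - v x) * \<phi> x)
          \<le> (f x (u x) - f x (v x)) * \<phi> x - (u x - v x) * y x"
        using split \<phi>(2) AE_space
      proof eventually_elim
        case (elim x)
        have "q x * (u x - v x) \<le> M * (\<bar>u x\<bar> + \<bar>v x\<bar>)"
        proof -
          have "q x * (u x - v x) \<le> \<bar>q x\<bar> * \<bar>u x - v x\<bar>" by (simp flip: abs_mult)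
          also have "\<dots> \<le> M * (\<bar>u x\<bar> + \<bar>v x\<bar>)" using bounds elim by (intro mult_mono) auto
          finally show ?thesis .
        qed
        moreover have "\<alpha> + \<beta> * u x + (D + K) \<le> C / 2 * \<bar>u x\<bar> powr p"
        proof -
          have "C / 2 * (s powr p + p * s powr (p - 1) * (u x - s)) \<le> C / 2 * \<bar>u x\<bar> powr p"
            using abs_powr_above_tangent[of p s "u x"] coercive s by (intro mult_left_mono) auto
          moreover have "C / 2 * (s powr p + p * s powr (p - 1) * (u x - s))
              = C / 2 * s powr p + \<beta> * u x - \<beta> * s"
            by (simp add: \<beta>_def algebra_simps)
          ultimately show ?thesis unfolding \<beta>(2) by (simp add: \<alpha>_def algebra_simps)
        qed
        ultimately have "\<alpha> + \<beta> * u x - M * \<bar>v x\<bar> \<le> f x (u x) - f x (v x) - q x * (u x - v x)"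
          using D(2)[of "\<bar>u x\<bar>"] coercive(1)[OF elim(3), of "u x"] bounds(1)[OF elim(3)]
          by (simp add: algebra_simps)
        then have "(\<alpha> + \<beta> * u x - M * \<bar>v x\<bar>) * \<phi> x
            \<le> (f x (u x) - f x (v x) - q x * (u x - v x)) * \<phi> x"
          using elim by (intro mult_right_mono)
        moreover have "(\<alpha> + \<beta> * u x - M * \<bar>v x\<bar>) * \<phi> x
            = \<alpha> * \<phi> x + \<beta> * ((u x - v x) * \<phi> x + v x * \<phi> x) - M * \<bar>v x * \<phi> x\<bar>"
          using elim by (simp add: abs_mult algebra_simps)
        ultimately show ?case using elim(1) by linarith
      qed
      then have "(LINT x|N. \<alpha> * \<phi> x + \<beta> * ((u x - v x) * \<phi> x + v x * \<phi> x) - M * \<bar>v x * \<phi> x\<bar>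
            - lam * ((u x - v x) * \<phi> x)) \<le> G"
        unfolding G using w\<phi> wy f\<phi> \<phi> v\<phi> by (intro integral_mono_AE) auto
      then have "\<alpha> * \<Phi> + \<beta> * (F + V) - M * V1 - lam * F \<le> G"
        using w\<phi> \<phi> v\<phi> by (simp add: F_def V_def V1_def \<Phi>_def)
      moreover have "C / 2 * p * s powr p * \<Phi> \<le> \<beta> * (F + V)"
      proof -
        have "s * \<Phi> \<le> F + V" using True F0 \<Phi> by (simp add: s_def)
        then have "\<beta> * (s * \<Phi>) \<le> \<beta> * (F + V)" using \<beta> by (intro mult_left_mono)
        then show ?thesis using \<beta>(2) by (metis mult.assoc)
      qed
      moreover have "0 \<le> - lam * F" using F eigen by (intro mult_nonneg_nonneg) auto
      ultimately have "C / 2 * s powr p * \<Phi> - E \<le> G"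
        by (simp add: \<alpha>_def E_def algebra_simps)
      moreover have "C / 2 * s powr p * \<Phi> = 2 * (c1 * F powr p)"
        using F \<Phi> by (simp add: s_def c1_def powr_divide powr_mult mult_ac)
      ultimately have "c1 * F powr p \<le> G" using F1[of F] True F0 by simp
      moreover have "c * F powr p \<le> c1 * F powr p" by (intro mult_right_mono) (auto simp: c_def)
      ultimately show "c * F powr p \<le> G" by linarith
    qed
  qed
qed

section \<open>The differential inequality\<close>

text \<open>At the first time where \<open>g\<close> meets \<open>P\<close> it does so from above. This is incompatible with \<open>g\<close>
  having there, to the left, a rate of increase \<open>\<kappa>\<close> larger than the derivative of \<open>P\<close>. The rate is
  expressed by increments since \<open>g\<close> may fail to be differentiable at that time.\<close>

lemma stays_above:
  fixes g P :: "real \<Rightarrow> real"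
  assumes g: "continuous_on {0..} g" and P: "continuous_on {0..} P" and start: "P 0 < g 0"
    and cross: "\<And>t. 0 < t \<Longrightarrow> g t = P t \<Longrightarrow> (\<And>s. 0 \<le> s \<Longrightarrow> s < t \<Longrightarrow> P s < g s) \<Longrightarrow>
      \<exists>D \<kappa>. (P has_real_derivative D) (at_left t) \<and> D < \<kappa> \<and>
        eventually (\<lambda>s. \<kappa> * (t - s) \<le> g t - g s) (at_left t)"
    and t: "0 \<le> t"
  shows "P t < g t"
proof (rule ccontr)
  assume bad: "\<not> P t < g t"
  define W where "W = (\<lambda>t. g t - P t)"
  have W: "continuous_on {0..} W" unfolding W_def by (intro continuous_intros g P)
  define S where "S = {t \<in> {0..}. W t \<le> 0}"
  have "closed S" unfolding S_def
    by (rule continuous_on_closed_Collect_le[OF W]) (auto intro: continuous_intros)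
  moreover have "S \<noteq> {}" using bad t by (auto simp: S_def W_def)
  moreover have "bdd_below S" by (auto simp: S_def)
  ultimately have Inf: "Inf S \<in> S" by (intro closed_contains_Inf)
  define t1 where "t1 = Inf S"
  have t1: "0 \<le> t1" "W t1 \<le> 0" using Inf by (auto simp: S_def t1_def)
  have below: "0 < W s" if "0 \<le> s" "s < t1" for s
    using that cInf_lower[OF _ \<open>bdd_below S\<close>, of s] by (force simp: S_def t1_def)
  have pos: "0 < t1" using t1 start by (cases "t1 = 0") (auto simp: W_def)
  have "\<exists>x\<ge>0. x \<le> t1 \<and> W x = 0"
    using t1 start W by (intro IVT2') (auto simp: W_def elim: continuous_on_subset)
  then have zero: "W t1 = 0" using below by (metis less_irrefl order_le_less)
  obtain D \<kappa> where D: "(P has_real_derivative D) (at_left t1)" "D < \<kappa>"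
    "eventually (\<lambda>s. \<kappa> * (t1 - s) \<le> g t1 - g s) (at_left t1)"
    using cross[OF pos] zero below by (force simp: W_def)
  have "((\<lambda>s. (P s - P t1) / (s - t1)) \<longlongrightarrow> D) (at_left t1)"
    using D(1) by (simp add: has_field_derivative_iff)
  then have "eventually (\<lambda>s. (P s - P t1) / (s - t1) < \<kappa>) (at_left t1)"
    using D(2) by (rule order_tendstoD)
  moreover have "eventually (\<lambda>s. s \<in> {0<..<t1}) (at_left t1)"
    using pos by (intro eventually_at_leftI[of 0]) auto
  ultimately have "eventually (\<lambda>s. False) (at_left t1)"
    using D(3)
  proof eventually_elim
    case (elim s)
    then have "P t1 - P s < \<kappa> * (t1 - s)" by (simp add: field_simps)
    with elim zero below[of s] show False by (auto simp: W_def)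
  qed
  then show False by simp
qed

text \<open>Superlinear forcing drives \<open>F\<close> to infinity in finite time because \<open>g\<close> stays above a multiple of
  \<open>F^q / (1 + t)\<close> for some \<open>q > 1\<close>. The quadratic bound on \<open>a\<close> leaves a second derivative of size \<open>F^p / (1 + t)\<^sup>2\<close>, which is what a comparison function with
  the factor \<open>1 / (1 + t)\<close> demands; the integral of that factor still diverges.\<close>

lemma no_global_solution:
  fixes F g h a b :: "real \<Rightarrow> real"
  assumes F: "\<And>t. 0 \<le> t \<Longrightarrow> (F has_real_derivative g t) (at t within {0..})"
    and g_cont: "continuous_on {0..} g"
    and h: "\<And>t. 0 \<le> t \<Longrightarrow> set_integrable lebesgue {0..t} h"
    and g: "\<And>t. 0 \<le> t \<Longrightarrow> g t = g 0 + (LINT s:{0..t}|lebesgue. h s)"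
    and ineq: "AE t in lebesgue. 0 < t \<longrightarrow> F 0 \<le> F t \<longrightarrow> c * F t powr p \<le> a t * h t + b t * g t"
    and b: "AE t in lebesgue. 0 < t \<longrightarrow> \<bar>b t\<bar> \<le> B" "0 \<le> B"
    and a: "\<And>t. 0 < t \<Longrightarrow> 0 < a t" "\<And>t. 0 < t \<Longrightarrow> a t \<le> A * (1 + t)\<^sup>2"
    and cp: "0 < c" "1 < p" and start: "0 < F 0" "0 < g 0"
  shows False
proof -
  have "0 < A * (1 + 1)\<^sup>2" using a(1)[of 1] a(2)[of 1] by linarith
  then have A: "0 < A" by simp
  have F': "(F has_real_derivative g t) (at t)" if "0 < t" for t
  proof -
    have "at t within {0..} = at t" using that by (intro at_within_interior) simp
    then show ?thesis using F[of t] that by simp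
  qed
  have F_cont: "continuous_on {0..} F" by (rule DERIV_continuous_on[where D = g]) (use F in simp)
  have F_mono: "F 0 \<le> F t" if "0 \<le> t" "\<And>s. 0 \<le> s \<Longrightarrow> s < t \<Longrightarrow> 0 \<le> g s" for t
    using \<open>0 \<le> t\<close>
  proof (rule DERIV_nonneg_imp_increasing_open)
    show "continuous_on {0..t} F" using F_cont by (rule continuous_on_subset) auto
    show "\<exists>y. (F has_real_derivative y) (at s) \<and> 0 \<le> y" if s: "0 < s" "s < t" for s
      using F'[OF s(1)] \<open>\<And>s. 0 \<le> s \<Longrightarrow> s < t \<Longrightarrow> 0 \<le> g s\<close>[of s] s by auto
  qed
  (* As long as g is nonnegative, R bounds the density of g from below wherever R is positive;
     it is continuous, while a and b need not be. *)
  define R where "R t = (c * F t powr p - B * g t) / (A * (1 + t)\<^sup>2)" for t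
  have lower: "eventually (\<lambda>s. \<kappa> * (t - s) \<le> g t - g s) (at_left t)"
    if t: "0 < t" and \<kappa>: "0 < \<kappa>" "\<kappa> < R t" and pos: "\<And>s. 0 \<le> s \<Longrightarrow> s \<le> t \<Longrightarrow> 0 \<le> g s" for t \<kappa>
  proof -
    have ge: "F 0 \<le> F s" if "0 \<le> s" "s \<le> t" for s using that pos by (intro F_mono) auto
    have ne: "\<forall>s\<in>{0..t}. F s \<noteq> 0" "\<forall>s\<in>{0..t}. A * (1 + s)\<^sup>2 \<noteq> 0" "{0..t} \<subseteq> {0..}"
      using ge start A by fastforce+
    have "continuous_on {0..t} R"
      unfolding R_def
      by (intro continuous_intros continuous_on_subset[OF F_cont ne(3)]
          continuous_on_subset[OF g_cont ne(3)]) (use ne in auto)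
    then have "(R \<longlongrightarrow> R t) (at t within {0..t})"
      using t by (auto simp: continuous_on_def)
    then have "(R \<longlongrightarrow> R t) (at_left t)"
      using t by (simp add: at_within_Icc_at_left)
    then have "eventually (\<lambda>s. \<kappa> < R s) (at_left t)" using \<kappa>(2) by (rule order_tendstoD)
    then obtain d where d: "d < t" "\<And>s. d < s \<Longrightarrow> s < t \<Longrightarrow> \<kappa> < R s"
      by (auto simp: eventually_at_left_field)
    have "eventually (\<lambda>s. s \<in> {max d 0<..<t}) (at_left t)"
      using t d by (intro eventually_at_leftI[of "max d 0"]) auto
    then show ?thesis
    proof eventually_elim
      case (elim s)
      then have s: "d < s" "0 < s" "s < t" by auto
      have sub: "set_integrable lebesgue {s<..t} h"
        using h[of t] s by (rule_tac set_integrable_subset) auto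
      have const: "set_integrable lebesgue {s<..t} (\<lambda>_. \<kappa>)"
        by (rule set_integrable_subset[OF absolutely_integrable_continuous_real[of s t]]) auto
      have "{0..t} = {0..s} \<union> {s<..t}" using s by auto
      moreover have "(LINT x:{0..s} \<union> {s<..t}|lebesgue. h x)
          = (LINT x:{0..s}|lebesgue. h x) + (LINT x:{s<..t}|lebesgue. h x)"
        using h[of s] s sub by (intro set_integral_Un) auto
      ultimately have diff: "g t - g s = (LINT x:{s<..t}|lebesgue. h x)"
        using g[of t] g[of s] s by simp
      have "AE x\<in>{s<..t} in lebesgue. \<kappa> \<le> h x"
        using ineq b(1)
      proof eventually_elim
        case (elim x)
        show ?case
        proof
          assume x: "x \<in> {s<..t}"
          then have x0: "0 < x" "x \<le> t" using s by auto
          have "\<kappa> < R x" using d(2)[of x] x s \<kappa> by (cases "x = t") auto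
          then have "\<kappa> * (A * (1 + x)\<^sup>2) < c * F x powr p - B * g x"
            using A x0 by (simp add: R_def pos_less_divide_eq)
          also have "c * F x powr p - B * g x \<le> a x * h x"
          proof -
            have "b x * g x \<le> B * g x" using elim(2) x0 pos[of x] by (intro mult_right_mono) auto
            then show ?thesis using elim(1) ge[of x] x0 by auto
          qed
          finally have 1: "\<kappa> * (A * (1 + x)\<^sup>2) < a x * h x" .
          have "\<kappa> * a x \<le> \<kappa> * (A * (1 + x)\<^sup>2)" using a(2)[OF x0(1)] \<kappa> by (intro mult_left_mono) auto
          with 1 have "a x * \<kappa> < a x * h x" by (simp add: mult.commute)
          then show "\<kappa> \<le> h x" using a(1)[OF x0(1)] by auto
        qed
      qed
      then have "(LINT x:{s<..t}|lebesgue. \<kappa>) \<le> (LINT x:{s<..t}|lebesgue. h x)"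
        using sub const by (intro set_integral_mono_AE) auto
      moreover have "(LINT x:{s<..t}|lebesgue. \<kappa>) = \<kappa> * (t - s)"
        using s by (simp add: set_lebesgue_integral_def)
      ultimately show ?case using diff by simp
    qed
  qed
  have g_pos: "0 < g t" if "0 \<le> t" for t
  proof (rule stays_above[where P = "\<lambda>_. 0", OF g_cont _ start(2) _ that])
    fix t assume t: "0 < t" "g t = 0" and pos: "\<And>s. 0 \<le> s \<Longrightarrow> s < t \<Longrightarrow> 0 < g s"
    have nonneg: "0 \<le> g s" if "0 \<le> s" "s \<le> t" for s
      using pos[of s] that t by (cases "s = t") auto
    have "F 0 \<le> F t" using t pos by (intro F_mono) (auto intro: less_imp_le)
    then have "0 < R t" using t start A cp by (auto simp: R_def)
    then show "\<exists>D \<kappa>. ((\<lambda>_. 0) has_real_derivative D) (at_left t) \<and> D < \<kappa> \<and>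
        eventually (\<lambda>s. \<kappa> * (t - s) \<le> g t - g s) (at_left t)"
      using lower[of t "R t / 2"] t nonneg
      by (intro exI[of _ 0] exI[of _ "R t / 2"]) auto
  qed auto
  have F_ge: "F 0 \<le> F t" if "0 \<le> t" for t
    using that g_pos by (intro F_mono) (auto intro: less_imp_le)
  have F_pos: "0 < F t" if "0 \<le> t" for t using F_ge[OF that] start by linarith
  (* With this exponent the derivative of F^q along g = \<epsilon> F^q is proportional to F^p, the same
     power as in the forcing. *)
  define q where "q = (p + 1) / 2"
  have q: "1 < q" "q < p" "q - 1 + q = p" using cp by (auto simp: q_def field_simps)
  (* The smallness conditions give the initial inequality, let half of the forcing dominate the
     damping, and let the other half dominate the derivative of the comparison function. *)
  obtain \<epsilon> where \<epsilon>: "0 < \<epsilon>" "\<epsilon> * F 0 powr q < g 0" "B * (\<epsilon> * F 0 powr (q - p)) < c / 2"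
    "\<epsilon> * (\<epsilon> * q) < c / 2 / A"
  proof -
    have lim: "((\<lambda>\<epsilon>. \<epsilon> * F 0 powr q) \<longlongrightarrow> 0) (at_right 0)"
      "((\<lambda>\<epsilon>. B * (\<epsilon> * F 0 powr (q - p))) \<longlongrightarrow> 0) (at_right 0)"
      "((\<lambda>\<epsilon>. \<epsilon> * (\<epsilon> * q)) \<longlongrightarrow> 0) (at_right 0)"
      by (auto intro!: tendsto_eq_intros)
    have pos: "0 < c / 2" "0 < c / 2 / A" using cp A by simp_all
    have "eventually (\<lambda>\<epsilon>. 0 < \<epsilon> \<and> \<epsilon> * F 0 powr q < g 0 \<and> B * (\<epsilon> * F 0 powr (q - p)) < c / 2
        \<and> \<epsilon> * (\<epsilon> * q) < c / 2 / A) (at_right 0)"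
      using eventually_at_right_less[of 0] order_tendstoD(2)[OF lim(1) start(2)]
        order_tendstoD(2)[OF lim(2) pos(1)] order_tendstoD(2)[OF lim(3) pos(2)]
      by eventually_elim blast
    then obtain \<epsilon> where "0 < \<epsilon> \<and> \<epsilon> * F 0 powr q < g 0 \<and> B * (\<epsilon> * F 0 powr (q - p)) < c / 2
        \<and> \<epsilon> * (\<epsilon> * q) < c / 2 / A"
      using eventually_happens'[OF trivial_limit_at_right_real] by blast
    then show thesis using that by blast
  qed
  define P where "P t = \<epsilon> * F t powr q / (1 + t)" for t
  have g_gt: "P t < g t" if "0 \<le> t" for t
  proof (rule stays_above[OF g_cont _ _ _ that])
    have ne: "\<forall>s\<in>{0..}. F s \<noteq> 0" "\<forall>s::real\<in>{0..}. 1 + s \<noteq> 0"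
      using F_pos by fastforce+
    show "continuous_on {0..} P"
      unfolding P_def
      by (intro continuous_intros F_cont) (use ne in auto)
    show "P 0 < g 0" using \<epsilon> by (simp add: P_def)
    fix t :: real assume t: "0 < t" and eq: "g t = P t"
    have Ft: "0 < F t" using F_pos t by simp
    have R_ge: "c / 2 / A * F t powr p / (1 + t)\<^sup>2 \<le> R t"
    proof -
      have "B * g t \<le> B * (\<epsilon> * F t powr q)"
      proof (rule mult_left_mono[OF _ b(2)])
        have "0 \<le> \<epsilon> * F t powr q" using \<epsilon>(1) by simp
        then show "g t \<le> \<epsilon> * F t powr q"
          using t mult_left_mono[of 1 "1 + t" "\<epsilon> * F t powr q"] by (simp add: eq P_def divide_le_eq)
      qed
      also have "F t powr q = F t powr (q - p) * F t powr p"
        by (simp flip: powr_add)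
      also have "B * (\<epsilon> * (F t powr (q - p) * F t powr p)) \<le> B * (\<epsilon> * (F 0 powr (q - p) * F t powr p))"
        using b \<epsilon> q start F_ge[of t] t by (intro mult_left_mono mult_right_mono powr_mono2') auto
      also have "\<dots> = B * (\<epsilon> * F 0 powr (q - p)) * F t powr p" by simp
      also have "\<dots> \<le> c / 2 * F t powr p" using \<epsilon>(3) by (intro mult_right_mono) auto
      finally have "c / 2 * F t powr p \<le> c * F t powr p - B * g t" by simp
      then have "c / 2 * F t powr p / (A * (1 + t)\<^sup>2) \<le> R t"
        unfolding R_def using A by (intro divide_right_mono) auto
      then show ?thesis by simp
    qed
    define D where "D = \<epsilon> * (q * F t powr (q - 1) * g t / (1 + t) - F t powr q / (1 + t)\<^sup>2)"
    have quotient: "(\<epsilon> * d * s - \<epsilon> * z) / (s * s) = \<epsilon> * (d / s - z / s\<^sup>2)" if "s \<noteq> 0" for d z s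
      using that by (simp add: field_simps power2_eq_square)
    have "(P has_real_derivative
        (\<epsilon> * (q * F t powr (q - 1) * g t) * (1 + t) - \<epsilon> * F t powr q) / ((1 + t) * (1 + t))) (at t)"
      unfolding P_def using t Ft F'[OF t] by (auto intro!: derivative_eq_intros)
    then have "(P has_real_derivative D) (at t)"
      unfolding D_def using t by (subst (asm) quotient) auto
    then have D: "(P has_real_derivative D) (at_left t)"
      by (rule has_field_derivative_at_within)
    have "D \<le> \<epsilon> * (q * F t powr (q - 1) * g t / (1 + t))"
      using \<epsilon> by (simp add: D_def algebra_simps)
    also have "\<dots> = \<epsilon> * (\<epsilon> * q) * (F t powr (q - 1) * F t powr q) / (1 + t)\<^sup>2"
      by (simp add: eq P_def power2_eq_square)
    also have "F t powr (q - 1) * F t powr q = F t powr p"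
      by (simp add: q(3) flip: powr_add)
    also have "\<epsilon> * (\<epsilon> * q) * F t powr p / (1 + t)\<^sup>2 < c / 2 / A * F t powr p / (1 + t)\<^sup>2"
      using \<epsilon>(4) Ft t by (intro divide_strict_right_mono mult_strict_right_mono) auto
    also note R_ge
    finally have DR: "D < R t" .
    have "0 < c / 2 / A * F t powr p / (1 + t)\<^sup>2" using cp A Ft t by simp
    with R_ge have "0 < R t" by linarith
    define \<kappa> where "\<kappa> = (max D 0 + R t) / 2"
    have \<kappa>: "D < \<kappa>" "0 < \<kappa>" "\<kappa> < R t" using DR \<open>0 < R t\<close> by (auto simp: \<kappa>_def)
    have "eventually (\<lambda>s. \<kappa> * (t - s) \<le> g t - g s) (at_left t)"
      using lower[OF t \<kappa>(2,3)] g_pos by (auto intro: less_imp_le)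
    then show "\<exists>D \<kappa>. (P has_real_derivative D) (at_left t) \<and> D < \<kappa> \<and>
        eventually (\<lambda>s. \<kappa> * (t - s) \<le> g t - g s) (at_left t)"
      using D \<kappa> by blast
  qed
  (* Nonincreasing in time, although its logarithmic part is unbounded. *)
  define Q where "Q t = F t powr (1 - q) + (q - 1) * \<epsilon> * ln (1 + t)" for t
  have Q_le: "Q t \<le> Q 0" if "0 \<le> t" for t
  proof (rule DERIV_nonpos_imp_decreasing_open[OF that])
    have ne: "\<forall>s\<in>{0..t}. F s \<noteq> 0" "\<forall>s\<in>{0..t}. 1 + s \<noteq> 0" "{0..t} \<subseteq> {0..}"
      using F_pos by fastforce+
    show "continuous_on {0..t} Q"
      unfolding Q_def
      by (intro continuous_intros continuous_on_subset[OF F_cont ne(3)]) (use ne in auto)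
    fix s assume s: "0 < s" "s < t"
    have Fs: "0 < F s" using F_pos s by simp
    have "(Q has_real_derivative (1 - q) * F s powr (- q) * g s + (q - 1) * \<epsilon> / (1 + s)) (at s)"
      unfolding Q_def using s Fs by (auto intro!: derivative_eq_intros F')
    moreover have "(1 - q) * F s powr (- q) * g s + (q - 1) * \<epsilon> / (1 + s) \<le> 0"
    proof -
      have "\<epsilon> / (1 + s) = F s powr (- q) * P s"
        using Fs by (simp add: P_def powr_minus field_simps)
      also have "\<dots> \<le> F s powr (- q) * g s" using g_gt[of s] s by (intro mult_left_mono) auto
      finally have "(q - 1) * (\<epsilon> / (1 + s)) \<le> (q - 1) * (F s powr (- q) * g s)"
        using q by (intro mult_left_mono) auto
      then show ?thesis by (simp add: algebra_simps)
    qed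
    ultimately show "\<exists>y. (Q has_real_derivative y) (at s) \<and> y \<le> 0" by blast
  qed
  have "0 < (q - 1) * \<epsilon>" using q \<epsilon> by simp
  define X where "X = Q 0 / ((q - 1) * \<epsilon>) + 1"
  have "0 < Q 0" using F_pos[of 0] by (simp add: Q_def)
  then have X: "0 < X" using \<open>0 < (q - 1) * \<epsilon>\<close> by (simp add: X_def add_pos_pos)
  have "(q - 1) * \<epsilon> * X \<le> Q (exp X - 1)" by (simp add: Q_def)
  also have "\<dots> \<le> Q 0" using X by (intro Q_le) simp
  also have "Q 0 < (q - 1) * \<epsilon> * X"
  proof -
    have "Q 0 < d * (Q 0 / d + 1)" if "0 < d" for d
      using that by (simp add: distrib_left)
    then show ?thesis using \<open>0 < (q - 1) * \<epsilon>\<close> unfolding X_def by blast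
  qed
  finally show False by simp
qed

section \<open>Blow-up\<close>

text \<open>A global solution would make \<open>\<langle>u t - v, \<phi>1\<rangle>\<close> a global solution of the differential inequality:
  testing with \<open>\<phi>1\<close> and inserting \<open>L v = f(x,v)\<close> turns the right-hand side of the equation into
  the quantity bounded from below by \<open>superlinear_forcing\<close>, with \<open>m\<close> the initial value.\<close>

theorem theorem2p3:
  fixes \<Omega> :: "(real^'n::finite) set"
    and m k :: nat and c :: "'n list \<Rightarrow> real^'n \<Rightarrow> real"
    and f :: "real^'n \<Rightarrow> real \<Rightarrow> real" and v \<phi>1 u0 u1 :: "real^'n \<Rightarrow> real"
    and a b :: "real \<Rightarrow> real" and T :: ereal
    and lam1 \<sigma> a0 a1 r C p :: real
    and u ut :: "real \<Rightarrow> real^'n \<Rightarrow> real"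
  assumes domain: "admissible_domain \<Omega>"
    and coeffs: "smooth_bounded_coeffs \<Omega> m c"
    and steady: "steady_state \<Omega> m c f v"
    and T_pos: "0 < T"
    and eigen: "adjoint_minus_eigenfunction \<Omega> m c k (\<lambda>x. deriv (f x) (v x)) lam1 \<phi>1"
    and eigen_neg: "lam1 < 0" "lam1 = - \<sigma>\<^sup>2"
    and eigen_nonneg: "AE x in lebesgue_on \<Omega>. 0 \<le> \<phi>1 x"
    and b_L1: "L1_loc_pos b"
    and a_C1: "\<And>t. 0 < t \<Longrightarrow> ereal t < T \<Longrightarrow> a differentiable (at t)"
      "continuous_on {t. 0 < t \<and> ereal t < T} (deriv a)"
    and a_lower: "0 < a0" "\<And>t. 0 \<le> t \<Longrightarrow> a0 \<le> a t"
    and f_C1: "\<And>x y. x \<in> \<Omega> \<Longrightarrow> f x differentiable (at y)"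
      "\<And>x. x \<in> \<Omega> \<Longrightarrow> continuous_on UNIV (deriv (f x))"
    and f_convex: "\<And>x. x \<in> \<Omega> \<Longrightarrow> convex_on UNIV (f x)"
    and f_bounded: "bounded ((\<lambda>x. f x (v x)) ` \<Omega>)"
      "bounded ((\<lambda>x. deriv (f x) (v x)) ` \<Omega>)"
    and f_lower: "0 < C" "1 < p" "\<And>x y. x \<in> \<Omega> \<Longrightarrow> C * \<bar>y\<bar> powr p \<le> f x y"
    and eigen_L1: "integrable (lebesgue_on \<Omega>) \<phi>1" "integrable (lebesgue_on \<Omega>) (\<lambda>x. v x * \<phi>1 x)"
    and a_upper: "0 \<le> r" "r < 1" "\<And>t. 0 \<le> t \<Longrightarrow> ereal t < T \<Longrightarrow> a t \<le> a1 * (t + 1) powr r"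
    and b_bounded: "L_infinity {t. 0 < t \<and> ereal t < T} b"
    and data: "u0 \<in> H1 \<Omega>" "u1 \<in> L2 \<Omega>"
    and data_pos: "0 < (LINT x|lebesgue_on \<Omega>. \<phi>1 x * u1 x)"
      "0 < (LINT x|lebesgue_on \<Omega>. \<phi>1 x * u0 x)"
    and regularity: "C1_L2 \<Omega> T (\<lambda>t x. u t x - v x) ut"
    and equation: "weak_solution \<Omega> m c k a b f v T u ut"
    and initial: "AE x in lebesgue_on \<Omega>. u 0 x = v x + u0 x"
      "AE x in lebesgue_on \<Omega>. ut 0 x = u1 x"
    and lifespan: "T < \<infinity> \<Longrightarrow>
      filterlim (\<lambda>t. L2_norm \<Omega> (\<lambda>x. u t x - v x)) at_top (at_left (real_of_ereal T))"
  shows "\<exists>Tstar::real. 0 < Tstar \<and> ereal Tstar \<le> T \<and>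
    filterlim (\<lambda>t. L2_norm \<Omega> (\<lambda>x. u t x - v x)) at_top (at_left Tstar)"
proof (cases T)
  case (real T')
  have "filterlim (\<lambda>t. L2_norm \<Omega> (\<lambda>x. u t x - v x)) at_top (at_left T')"
    using lifespan unfolding real by simp
  moreover have "0 < T'" using T_pos unfolding real by simp
  ultimately show ?thesis unfolding real by blast
next
  case MInf
  show ?thesis using T_pos unfolding MInf by simp
next
  case PInf
  let ?N = "lebesgue_on \<Omega>"
  have space: "space ?N = \<Omega>" by simp
  obtain y where graph: "adjoint_graph \<Omega> m c k \<phi>1 y"
    and y: "AE x in ?N. y x - deriv (f x) (v x) * \<phi>1 x = lam1 * \<phi>1 x"
    and nonzero: "\<not> (AE x in ?N. \<phi>1 x = 0)"
    using eigen unfolding adjoint_minus_eigenfunction_def by blast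
  have \<phi>1: "\<phi>1 \<in> L2 \<Omega>" and y_L2: "y \<in> L2 \<Omega>" using graph unfolding adjoint_graph_def by blast+
  define w where "w t x = u t x - v x" for t x
  define F g where "F t = L2_inner \<Omega> (w t) \<phi>1" and "g t = L2_inner \<Omega> (ut t) \<phi>1" for t
  have C1: "C1_L2 \<Omega> \<infinity> w ut" using regularity unfolding PInf w_def .
  have w_L2: "w t \<in> L2 \<Omega>" "ut t \<in> L2 \<Omega>" if "0 \<le> t" for t
    using C1 that unfolding C1_L2_def by simp_all
  have half_line: "{t. 0 \<le> t \<and> ereal t < \<infinity>} = {0..}" by auto
  have F_deriv: "(F has_real_derivative g t) (at t within {0..})" if "0 \<le> t" for t
    using C1_L2_pairing(1)[OF C1 \<phi>1, unfolded half_line, of t] that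
    unfolding F_def g_def by simp
  have g_cont: "continuous_on {0..} g"
    using C1_L2_pairing(2)[OF C1 \<phi>1, unfolded half_line] unfolding g_def .
  obtain h where H: "\<forall>t. 0 \<le> t \<and> ereal t < T \<longrightarrow> set_integrable lebesgue {0..t} h \<and>
        L2_inner \<Omega> (ut t) \<phi>1 = L2_inner \<Omega> (ut 0) \<phi>1 + (LINT s:{0..t}|lebesgue. h s)"
    and weak: "AE t in lebesgue. 0 < t \<and> ereal t < T \<longrightarrow>
      integrable ?N (\<lambda>x. (f x (u t x) - diff_op m c v x) * \<phi>1 x) \<and>
      a t * h t + b t * L2_inner \<Omega> (ut t) \<phi>1 + L2_inner \<Omega> (\<lambda>x. u t x - v x) y
        = L2_inner \<Omega> (\<lambda>x. f x (u t x) - diff_op m c v x) \<phi>1"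
    using mp[OF spec[OF spec[OF equation[unfolded weak_solution_def]]] graph]
    by (elim exE conjE) (rule that)
  have h: "set_integrable lebesgue {0..t} h" "g t = g 0 + (LINT s:{0..t}|lebesgue. h s)"
    if "0 \<le> t" for t
  proof -
    have "0 \<le> t \<and> ereal t < T" using that PInf by simp
    then show "set_integrable lebesgue {0..t} h" "g t = g 0 + (LINT s:{0..t}|lebesgue. h s)"
      using H unfolding g_def by blast+
  qed
  have Lv: "diff_op m c v x = f x (v x)" if "x \<in> \<Omega>" for x
    using steady that by (simp add: steady_state_def)
  have F0: "0 < F 0"
  proof -
    have "AE x in ?N. w 0 x = u0 x"
      using initial(1) by (auto simp: w_def elim: eventually_mono)
    then have "F 0 = L2_inner \<Omega> u0 \<phi>1"
      unfolding F_def using w_L2(1)[of 0] \<phi>1 data(1) by (intro L2_inner_cong_AE) (auto simp: H1_def)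
    also have "\<dots> = (LINT x|?N. \<phi>1 x * u0 x)"
      by (simp add: L2_inner_def mult.commute)
    finally have "F 0 = (LINT x|?N. \<phi>1 x * u0 x)" .
    then show ?thesis using data_pos by simp
  qed
  have g0: "0 < g 0"
  proof -
    have "g 0 = L2_inner \<Omega> u1 \<phi>1"
      unfolding g_def by (rule L2_inner_cong_AE[OF w_L2(2)[of 0] data(2) \<phi>1 initial(2)]) simp
    also have "\<dots> = (LINT x|?N. \<phi>1 x * u1 x)"
      by (simp add: L2_inner_def mult.commute)
    finally have "g 0 = (LINT x|?N. \<phi>1 x * u1 x)" .
    then show ?thesis using data_pos by simp
  qed
  have mass: "0 < (LINT x|?N. \<phi>1 x)"
    using nonzero integral_nonneg_eq_0_iff_AE[OF eigen_L1(1) eigen_nonneg]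
      integral_nonneg_AE[OF eigen_nonneg] by linarith
  obtain K where "\<And>x. x \<in> \<Omega> \<Longrightarrow> \<bar>f x (v x)\<bar> \<le> K" using f_bounded(1) by (auto simp: bounded_iff)
  then have K: "f x (v x) \<le> K" if "x \<in> space ?N" for x
    using that abs_le_D1 space by blast
  obtain M where M0: "0 < M" "\<And>x. x \<in> \<Omega> \<Longrightarrow> \<bar>deriv (f x) (v x)\<bar> \<le> M"
    using f_bounded(2) by (auto simp: bounded_pos)
  then have M: "\<bar>deriv (f x) (v x)\<bar> \<le> M" if "x \<in> space ?N" for x
    using that by auto
  have tangent: "deriv (f x) (v x) * (z - v x) \<le> f x z - f x (v x)" if "x \<in> space ?N" for x z
  proof (rule convex_on_imp_above_tangent)
    have x: "x \<in> \<Omega>" using that by simp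
    show "convex_on UNIV (f x)" by (rule f_convex[OF x])
    show "(f x has_real_derivative deriv (f x) (v x)) (at (v x))"
      using f_C1(1)[OF x] by (simp add: DERIV_deriv_iff_real_differentiable)
  qed auto
  have coercive: "C * \<bar>z\<bar> powr p \<le> f x z" if "x \<in> space ?N" for x z
    using f_lower(3) that by simp
  obtain c0 where c0: "0 < c0"
    "\<And>u. \<lbrakk>integrable ?N (\<lambda>x. (u x - v x) * \<phi>1 x); integrable ?N (\<lambda>x. (u x - v x) * y x);
        integrable ?N (\<lambda>x. (f x (u x) - f x (v x)) * \<phi>1 x); F 0 \<le> (LINT x|?N. (u x - v x) * \<phi>1 x)\<rbrakk>
      \<Longrightarrow> c0 * (LINT x|?N. (u x - v x) * \<phi>1 x) powr p
          \<le> (LINT x|?N. (f x (u x) - f x (v x)) * \<phi>1 x) - (LINT x|?N. (u x - v x) * y x)"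
    by (rule superlinear_forcing[OF eigen_L1(1) eigen_nonneg mass eigen_L1(2) tangent coercive
          f_lower(1,2) K M less_imp_le[OF M0(1)] y eigen_neg(1) F0],
        assumption+, rule that)
  have ineq: "AE t in lebesgue. 0 < t \<longrightarrow> F 0 \<le> F t \<longrightarrow> c0 * F t powr p \<le> a t * h t + b t * g t"
    using weak
  proof eventually_elim
    case (elim t)
    show ?case
    proof (intro impI)
      assume t: "0 < t" "F 0 \<le> F t"
      then have eq: "integrable ?N (\<lambda>x. (f x (u t x) - diff_op m c v x) * \<phi>1 x)"
        "a t * h t + b t * g t + L2_inner \<Omega> (w t) y
          = L2_inner \<Omega> (\<lambda>x. f x (u t x) - diff_op m c v x) \<phi>1"
        using elim PInf by (simp_all add: g_def w_def[abs_def])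
      have "integrable ?N (\<lambda>x. (f x (u t x) - f x (v x)) * \<phi>1 x)
          \<longleftrightarrow> integrable ?N (\<lambda>x. (f x (u t x) - diff_op m c v x) * \<phi>1 x)"
        by (intro Bochner_Integration.integrable_cong) (auto simp: Lv)
      then have 1: "integrable ?N (\<lambda>x. (f x (u t x) - f x (v x)) * \<phi>1 x)"
        using eq(1) by blast
      have 2: "L2_inner \<Omega> (\<lambda>x. f x (u t x) - diff_op m c v x) \<phi>1
          = (LINT x|?N. (f x (u t x) - f x (v x)) * \<phi>1 x)"
        unfolding L2_inner_def by (intro Bochner_Integration.integral_cong) (auto simp: Lv)
      have "c0 * F t powr p \<le> (LINT x|?N. (f x (u t x) - f x (v x)) * \<phi>1 x) - L2_inner \<Omega> (w t) y"
        using c0(2)[of "u t"] 1 L2_inner_integrable[OF w_L2(1)[of t] \<phi>1]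
          L2_inner_integrable[OF w_L2(1)[of t] y_L2] t
        by (simp add: F_def L2_inner_def w_def)
      then show "c0 * F t powr p \<le> a t * h t + b t * g t" using eq(2) 2 by simp
    qed
  qed
  have "{t. 0 < t \<and> ereal t < T} = {0<..}" using PInf by auto
  then have "L_infinity {0<..} b" using b_bounded by argo
  then obtain B where "AE t in lebesgue_on {0<..}. \<bar>b t\<bar> \<le> B"
    unfolding L_infinity_def by blast
  then have B: "AE t in lebesgue. 0 < t \<longrightarrow> \<bar>b t\<bar> \<le> max B 0"
    by (subst (asm) AE_restrict_space_iff) (auto elim!: eventually_mono)
  have "a 0 \<le> a1" using a_upper(3)[of 0] PInf by simp
  then have a1: "0 < a1" using a_lower(1) a_lower(2)[of 0] by linarith
  (* The exponent r is below 2, so the growth of a is at most quadratic. *)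
  have a_quad: "a t \<le> a1 * (1 + t)\<^sup>2" if "0 < t" for t
  proof -
    have "a t \<le> a1 * (t + 1) powr r" using a_upper(3)[of t] that PInf by simp
    also have "\<dots> \<le> a1 * (t + 1) powr 2"
      using a1 a_upper(2) that by (intro mult_left_mono powr_mono) auto
    finally show ?thesis using that by (simp add: add.commute)
  qed
  have a_pos: "0 < a t" if "0 < t" for t
    using a_lower(1) a_lower(2)[of t] that by linarith
  have B_nonneg: "0 \<le> max B 0" by simp
  have False
    by (rule no_global_solution[OF F_deriv g_cont h ineq B B_nonneg a_pos a_quad c0(1) f_lower(2) F0 g0])
  then show ?thesis ..
qed

end
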